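(* Let $X,Y,Z$ be real Banach spaces and let $B_0: X\times Y\to Z$ be a norming bilinear map. Let $R$, $C$ and $WC$ be the subsets of $L(Z,Z)$ consisting of the rank one, compact and weakly compact operators, respectively, and put $R\circ B_0=\{T\circ B_0: T\in R\}$, $C\circ B_0=\{T\circ B_0: T\in C\}$ and $WC\circ B_0=\{T\circ B_0: T\in WC\}$, which are sets of bilinear maps $X\times Y\to Z$. Then the following are equivalent. (1) $Z$ has the Daugavet property. (2) $Z$ has the $B_0$-Daugavet property with respect to $R\circ B_0$. (3) $Z$ has the $B_0$-Daugavet property with respect to $C\circ B_0$. (4) $Z$ has the $B_0$-Daugavet property with respect to $WC\circ B_0$. (5) For every $z'\in S_{Z'}$, every $z\in S_Z$ and every $\varepsilon>0$ there is an element $(x,y)\in S(z'\circ B_0,\varepsilon)$ such that $$\|z+B_0(x,y)\|\ge 2-\varepsilon.$$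
   Context: All Banach spaces are real. $B_X$, $U_X$, $S_X$ denote the closed unit ball, the open unit ball and the unit sphere of $X$; $X'$ is the dual space; $L(Z,Z)$ is the space of continuous linear operators on $Z$. The norm of a continuous bilinear map $B: X\times Y\to Z$ is $\|B\|=\sup\{\|B(x,y)\|: x\in B_X, y\in B_Y\}$. A Banach space $Z$ has the Daugavet property if $\|\mathrm{Id}+Q\|=1+\|Q\|$ for every rank one continuous linear operator $Q: Z\to Z$. A continuous bilinear map $B_0: X\times Y\to Z$ of norm one is called norming if $B_0(U_X\times U_Y)=U_Z$. For such $B_0$ and a class $V$ of continuous bilinear maps $X\times Y\to Z$, $Z$ has the $B_0$-Daugavet property with respect to $V$ if $\|B_0+B\|=1+\|B\|$ for all $B\in V$. For a norm one bilinear form $b: X\times Y\to\mathbb R$ and $\varepsilon>0$, $S(b,\varepsilon)=\{(x,y): x\in B_X,\ y\in B_Y,\ b(x,y)\ge 1-\varepsilon\}$. For $z'\in S_{Z'}$, $z'\circ B_0$ is the bilinear form $(x,y)\mapsto\langle B_0(x,y),z'\rangle$, which has norm one since $B_0$ is norming. *)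

theory Defs
  imports "HOL-Analysis.Analysis"
begin

text \<open>Continuous bilinear maps are curried functions satisfying \<open>bounded_bilinear\<close>. The
  supremum below is the usual norm only for those (otherwise it may be of an unbounded set).\<close>

definition bilinear_norm ::
  "('x::real_normed_vector \<Rightarrow> 'y::real_normed_vector \<Rightarrow> 'z::real_normed_vector) \<Rightarrow> real"
  where "bilinear_norm B = (SUP (x, y)\<in>cball 0 1 \<times> cball 0 1. norm (B x y))"

definition norming ::
  "('x::real_normed_vector \<Rightarrow> 'y::real_normed_vector \<Rightarrow> 'z::real_normed_vector) \<Rightarrow> bool"
  where "norming B0 \<longleftrightarrow> bounded_bilinear B0 \<and> bilinear_norm B0 = 1 \<and>
    (\<lambda>(x, y). B0 x y) ` (ball 0 1 \<times> ball 0 1) = ball 0 1"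

definition weak_topology :: "'z::real_normed_vector topology"
  where "weak_topology =
    topology_generated_by {blinfun_apply f -` U | (f :: 'z \<Rightarrow>\<^sub>L real) U. open U}"

definition rank_one_operators :: "('z::real_normed_vector \<Rightarrow>\<^sub>L 'z) set"
  where "rank_one_operators = {T. dim (range (blinfun_apply T)) = 1}"

definition compact_operators :: "('z::real_normed_vector \<Rightarrow>\<^sub>L 'z) set"
  where "compact_operators = {T. compact (closure (blinfun_apply T ` cball 0 1))}"

definition weakly_compact_operators :: "('z::real_normed_vector \<Rightarrow>\<^sub>L 'z) set"
  where "weakly_compact_operators =
    {T. compactin weak_topology (weak_topology closure_of (blinfun_apply T ` cball 0 1))}"

definition daugavet_property :: "'z::real_normed_vector itself \<Rightarrow> bool"
  where "daugavet_property _ \<longleftrightarrow>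
    (\<forall>Q\<in>(rank_one_operators :: ('z \<Rightarrow>\<^sub>L 'z) set). norm (id_blinfun + Q) = 1 + norm Q)"

definition B0_daugavet_property ::
  "('x::real_normed_vector \<Rightarrow> 'y::real_normed_vector \<Rightarrow> 'z::real_normed_vector) \<Rightarrow>
   ('x \<Rightarrow> 'y \<Rightarrow> 'z) set \<Rightarrow> bool"
  where "B0_daugavet_property B0 V \<longleftrightarrow>
    (\<forall>B\<in>V. bilinear_norm (\<lambda>x y. B0 x y + B x y) = 1 + bilinear_norm B)"

definition comp_bilinear ::
  "('z::real_normed_vector \<Rightarrow>\<^sub>L 'w::real_normed_vector) \<Rightarrow> ('x \<Rightarrow> 'y \<Rightarrow> 'z) \<Rightarrow> 'x \<Rightarrow> 'y \<Rightarrow> 'w"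
  where "comp_bilinear T B = (\<lambda>x y. blinfun_apply T (B x y))"

definition bilinear_slice ::
  "('x::real_normed_vector \<Rightarrow> 'y::real_normed_vector \<Rightarrow> real) \<Rightarrow> real \<Rightarrow> ('x \<times> 'y) set"
  where "bilinear_slice b \<epsilon> = {(x, y). x \<in> cball 0 1 \<and> y \<in> cball 0 1 \<and> b x y \<ge> 1 - \<epsilon>}"

end

theory Submission
  imports Defs
begin

text \<open>Since \<open>B0\<close> maps the product of the open unit balls onto the open unit ball, composition with
  \<open>B0\<close> preserves operator norms; so (2)--(4) are the Daugavet equation for the operators of the
  respective class, and (5) is the slice characterisation of the Daugavet property. What remains
  is the Daugavet equation for a weakly compact \<open>T\<close>.

  Inside a slice on which \<open>T\<close> almost attains its norm, the Daugavet property yields a sequence \<open>x n\<close>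
  such that each \<open>x n\<close> is almost \<open>\<ell>\<^sub>1\<close>-orthogonal to the convex hulls of the earlier \<open>x i\<close> and
  \<open>T (x i)\<close>. By weak compactness the closed convex hulls of the tails of \<open>T (x n)\<close> have a common
  point, so some convex combination \<open>u\<close> of \<open>T (x 0), \<dots>, T (x (m - 1))\<close> almost equals \<open>T b\<close>
  for a convex combination \<open>b\<close> of later \<open>x n\<close>. Then \<open>norm (b + T b)\<close> is close to
  \<open>norm (b + u)\<close>, which is almost \<open>1 + norm u\<close>, hence almost \<open>1 + norm T\<close>.\<close>

subsection \<open>The Hahn--Banach theorem\<close>

text \<open>Homogeneity is stated as an inequality, which is what infima give directly; scaling back
  by \<open>1 / t\<close> yields the equality in \<open>sublinear_scaleR\<close>.\<close>

definition sublinear :: "('a::real_vector \<Rightarrow> real) \<Rightarrow> bool"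
  where "sublinear q \<longleftrightarrow> (\<forall>x y. q (x + y) \<le> q x + q y) \<and> (\<forall>t\<ge>0. \<forall>x. q (t *\<^sub>R x) \<le> t * q x)"

lemma sublinear_add: "sublinear q \<Longrightarrow> q (x + y) \<le> q x + q y"
  by (simp add: sublinear_def)

lemma sublinear_scaleR_le: "sublinear q \<Longrightarrow> t \<ge> 0 \<Longrightarrow> q (t *\<^sub>R x) \<le> t * q x"
  by (simp add: sublinear_def)

lemma sublinear_zero: "sublinear q \<Longrightarrow> q 0 = 0"
  using sublinear_scaleR_le[of q 0 0] sublinear_add[of q 0 0] by simp

lemma sublinear_scaleR:
  assumes "sublinear q" "t \<ge> 0"
  shows "q (t *\<^sub>R x) = t * q x"
proof (cases "t = 0")
  case False
  then have "t > 0" using assms by simp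
  have "q ((1 / t) *\<^sub>R t *\<^sub>R x) \<le> 1 / t * q (t *\<^sub>R x)"
    using assms by (intro sublinear_scaleR_le) auto
  then have "t * q x \<le> q (t *\<^sub>R x)"
    using \<open>t > 0\<close> by (simp add: field_simps)
  then show ?thesis using sublinear_scaleR_le[OF assms, of x] by simp
qed (use sublinear_zero[OF assms(1)] in simp)

lemma sublinear_minus: "sublinear q \<Longrightarrow> - q (- x) \<le> q x"
  using sublinear_add[of q x "- x"] sublinear_zero[of q] by simp

text \<open>The infima are finite because every member satisfies \<open>- p (- v) \<le> q v\<close>.
  For subadditivity, the smaller of two members \<open>q\<close> and \<open>r\<close> serves at both
  points. This bounds chains in Zorn's lemma.\<close>

lemma sublinear_INF_chain:
  assumes ne: "Q \<noteq> {}" and sub: "\<And>q. q \<in> Q \<Longrightarrow> sublinear q"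
    and chain: "\<And>q r. q \<in> Q \<Longrightarrow> r \<in> Q \<Longrightarrow> q \<le> r \<or> r \<le> q"
    and le: "\<And>q. q \<in> Q \<Longrightarrow> q \<le> p"
  shows "sublinear (\<lambda>v. INF q\<in>Q. q v)" and "\<And>q. q \<in> Q \<Longrightarrow> (\<lambda>v. INF q\<in>Q. q v) \<le> q"
proof -
  have lb: "- p (- v) \<le> q v" if "q \<in> Q" for q v
    using sublinear_minus[OF sub[OF that], of v] le_funD[OF le[OF that], of "- v"] by linarith
  have bdd: "bdd_below ((\<lambda>q. q v) ` Q)" for v
    using lb by (intro bdd_belowI2[where m = "- p (- v)"])
  have lower: "(INF q\<in>Q. q v) \<le> q v" if "q \<in> Q" for q v
    by (rule cINF_lower[OF bdd that])
  then show "\<And>q. q \<in> Q \<Longrightarrow> (\<lambda>v. INF q\<in>Q. q v) \<le> q"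
    by (simp add: le_fun_def)
  show "sublinear (\<lambda>v. INF q\<in>Q. q v)"
    unfolding sublinear_def
  proof (intro conjI allI impI)
    fix x y
    have "(INF q\<in>Q. q (x + y)) - r y \<le> (INF q\<in>Q. q x)" if r: "r \<in> Q" for r
    proof (rule cINF_greatest[OF ne])
      fix q assume q: "q \<in> Q"
      obtain s where s: "s \<in> Q" "s \<le> q" "s \<le> r"
        using chain[OF q r] q r by blast
      have "(INF q\<in>Q. q (x + y)) \<le> s (x + y)" by (rule lower[OF s(1)])
      also have "\<dots> \<le> s x + s y" by (rule sublinear_add[OF sub[OF s(1)]])
      also have "\<dots> \<le> q x + r y" using s by (intro add_mono) (auto simp: le_fun_def)
      finally show "(INF q\<in>Q. q (x + y)) - r y \<le> q x" by simp
    qed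
    then have "(INF q\<in>Q. q (x + y)) - (INF q\<in>Q. q x) \<le> (INF q\<in>Q. q y)"
      by (intro cINF_greatest[OF ne]) (simp add: algebra_simps)
    then show "(INF q\<in>Q. q (x + y)) \<le> (INF q\<in>Q. q x) + (INF q\<in>Q. q y)" by simp
  next
    fix t :: real and x assume t: "0 \<le> t"
    have *: "(INF q\<in>Q. q (t *\<^sub>R x)) \<le> t * q x" if "q \<in> Q" for q
      using lower[OF that, of "t *\<^sub>R x"] sublinear_scaleR_le[OF sub[OF that] t, of x] by linarith
    show "(INF q\<in>Q. q (t *\<^sub>R x)) \<le> t * (INF q\<in>Q. q x)"
    proof (cases "t = 0")
      case True
      then show ?thesis using * ne by auto
    next
      case False
      then have "(INF q\<in>Q. q (t *\<^sub>R x)) / t \<le> (INF q\<in>Q. q x)"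
        using t * by (intro cINF_greatest[OF ne]) (simp add: field_simps)
      then show ?thesis using False t by (simp add: field_simps)
    qed
  qed
qed

text \<open>The infimum \<open>r\<close> below is the largest sublinear functional under
  \<open>q\<close> with \<open>r (- c) \<le> - d\<close> on \<open>C\<close>, so every linear
  functional under \<open>r\<close> is at least \<open>d\<close> on \<open>C\<close>. A singleton
  \<open>C\<close> serves the minimality argument for Hahn--Banach, a general one the separation of
  convex sets.\<close>

lemma sublinear_shrink:
  assumes q: "sublinear q" and C: "convex C" "C \<noteq> {}" and d: "\<And>c. c \<in> C \<Longrightarrow> d \<le> q c"
  obtains r where "sublinear r" "r \<le> q" "\<And>c. c \<in> C \<Longrightarrow> r (- c) \<le> - d"
proof -
  define E where "E = (\<lambda>v. {q (v + t *\<^sub>R c) - t * d | t c. t \<ge> 0 \<and> c \<in> C})"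
  define r where "r = (\<lambda>v. Inf (E v))"
  obtain c0 where c0: "c0 \<in> C" using C by blast
  have lb: "- q (- v) \<le> q (v + t *\<^sub>R c) - t * d" if "t \<ge> 0" "c \<in> C" for v t c
  proof -
    have "t * d \<le> t * q c" using d that by (intro mult_left_mono)
    also have "\<dots> = q (t *\<^sub>R c)" using sublinear_scaleR[OF q that(1)] by simp
    also have "\<dots> \<le> q (v + t *\<^sub>R c) + q (- v)"
      using sublinear_add[OF q, of "v + t *\<^sub>R c" "- v"] by simp
    finally show ?thesis by simp
  qed
  have bdd: "bdd_below (E v)" for v
    using lb by (intro bdd_belowI[where m = "- q (- v)"]) (auto simp: E_def)
  have lower: "r v \<le> q (v + t *\<^sub>R c) - t * d" if "t \<ge> 0" "c \<in> C" for v t c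
    unfolding r_def using that by (intro cInf_lower[OF _ bdd]) (auto simp: E_def)
  have greatest: "L \<le> r v" if "\<And>t c. t \<ge> 0 \<Longrightarrow> c \<in> C \<Longrightarrow> L \<le> q (v + t *\<^sub>R c) - t * d" for L v
    unfolding r_def
  proof (rule cInf_greatest)
    show "E v \<noteq> {}" using c0 unfolding E_def by fastforce
  qed (use that in \<open>auto simp: E_def\<close>)
  have "r (x + y) \<le> r x + r y" for x y
  proof -
    have *: "r (x + y) - (q (x + t *\<^sub>R c) - t * d) \<le> r y" if tc: "t \<ge> 0" "c \<in> C" for t c
    proof (rule greatest)
      fix s c' assume sc: "(0::real) \<le> s" "c' \<in> C"
      \<comment> \<open>Convexity merges both multiples into a single multiple of a point of
        \<open>C\<close>; for total weight 0 any point will do.\<close>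
      obtain c'' where c'': "c'' \<in> C" "(t + s) *\<^sub>R c'' = t *\<^sub>R c + s *\<^sub>R c'"
      proof (cases "t + s = 0")
        case True
        then have "t = 0" "s = 0" using tc sc by auto
        then show ?thesis using that[OF c0] by simp
      next
        case False
        then have "t + s > 0" using tc sc by simp
        have "(t / (t + s)) *\<^sub>R c + (s / (t + s)) *\<^sub>R c' \<in> C"
          using tc sc \<open>t + s > 0\<close> by (intro convexD[OF C(1)]) (auto simp: add_divide_distrib[symmetric])
        then show ?thesis
          using that \<open>t + s > 0\<close> by (simp add: scaleR_add_right)
      qed
      have "r (x + y) \<le> q (x + y + (t + s) *\<^sub>R c'') - (t + s) * d"
        using tc sc c'' by (intro lower) auto
      also have "x + y + (t + s) *\<^sub>R c'' = (x + t *\<^sub>R c) + (y + s *\<^sub>R c')"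
        using c''(2) by simp
      also have "q \<dots> \<le> q (x + t *\<^sub>R c) + q (y + s *\<^sub>R c')"
        by (rule sublinear_add[OF q])
      finally show "r (x + y) - (q (x + t *\<^sub>R c) - t * d) \<le> q (y + s *\<^sub>R c') - s * d"
        by (simp add: algebra_simps)
    qed
    have "r (x + y) - r y \<le> r x"
      by (rule greatest) (use * in \<open>simp add: algebra_simps\<close>)
    then show ?thesis by simp
  qed
  moreover have "r (s *\<^sub>R x) \<le> s * r x" if s: "s \<ge> 0" for s x
  proof (cases "s = 0")
    case True
    then show ?thesis using lower[of 0 c0 0] c0 sublinear_zero[OF q] by simp
  next
    case False
    then have "s > 0" using s by simp
    have "r (s *\<^sub>R x) / s \<le> r x"
    proof (rule greatest)
      fix t c assume tc: "(0::real) \<le> t" "c \<in> C"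
      have "r (s *\<^sub>R x) \<le> q (s *\<^sub>R x + (s * t) *\<^sub>R c) - (s * t) * d"
        using tc s by (intro lower) auto
      also have "s *\<^sub>R x + (s * t) *\<^sub>R c = s *\<^sub>R (x + t *\<^sub>R c)"
        by (simp add: scaleR_add_right)
      also have "q \<dots> = s * q (x + t *\<^sub>R c)" by (rule sublinear_scaleR[OF q s])
      finally show "r (s *\<^sub>R x) / s \<le> q (x + t *\<^sub>R c) - t * d"
        using \<open>s > 0\<close> by (simp add: field_simps)
    qed
    then show ?thesis using \<open>s > 0\<close> by (simp add: field_simps)
  qed
  ultimately have "sublinear r" by (simp add: sublinear_def)
  moreover have "r \<le> q" using lower[of 0 c0] c0 by (simp add: le_fun_def)
  moreover have "r (- c) \<le> - d" if "c \<in> C" for c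
    using lower[of 1 c "- c"] that sublinear_zero[OF q] by simp
  ultimately show ?thesis by (rule that)
qed

text \<open>By Zorn's lemma there is a minimal sublinear functional below \<open>p\<close>, and \<open>sublinear_shrink\<close>
  applied to a singleton shows that a minimal one is odd, hence linear.\<close>

theorem hahn_banach_sublinear:
  fixes p :: "'a::real_vector \<Rightarrow> real"
  assumes p: "sublinear p"
  obtains f where "linear f" "\<And>x. f x \<le> p x"
proof -
  define S where "S = {q. sublinear q \<and> q \<le> p}"
  have "\<exists>m\<in>S. \<forall>a\<in>S. a \<le> m \<longrightarrow> a = m"
  proof (rule predicate_Zorn)
    \<comment> \<open>The pointwise order is reversed, so that a maximal element in Zorn's lemma is
      a minimal functional.\<close>
    show "partial_order_on S (relation_of (\<lambda>x y. y \<le> x) S)"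
      by (auto simp: partial_order_on_def preorder_on_def refl_on_def trans_def antisym_def
          relation_of_def)
  next
    fix Q assume "Q \<in> Chains (relation_of (\<lambda>x y. y \<le> x) S)"
    then have Q: "Q \<subseteq> S" "\<And>q r. q \<in> Q \<Longrightarrow> r \<in> Q \<Longrightarrow> q \<le> r \<or> r \<le> q"
      by (auto simp: Chains_def relation_of_def)
    show "\<exists>u\<in>S. \<forall>a\<in>Q. u \<le> a"
    proof (cases "Q = {}")
      case True
      then show ?thesis using p by (auto simp: S_def)
    next
      case False
      have "sublinear (\<lambda>v. INF q\<in>Q. q v)" "\<And>q. q \<in> Q \<Longrightarrow> (\<lambda>v. INF q\<in>Q. q v) \<le> q"
        using sublinear_INF_chain[OF False _ Q(2), of p] Q(1) by (auto simp: S_def)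
      moreover from this False Q(1) have "(\<lambda>v. INF q\<in>Q. q v) \<le> p"
        unfolding S_def by (metis (mono_tags, lifting) all_not_in_conv mem_Collect_eq order_trans subsetD)
      ultimately show ?thesis by (auto simp: S_def)
    qed
  qed
  then obtain m where m: "sublinear m" "m \<le> p"
    and min: "\<And>a. sublinear a \<Longrightarrow> a \<le> m \<Longrightarrow> a = m"
    unfolding S_def by (blast intro: order_trans)
  have neg: "m (- x) = - m x" for x
  proof -
    obtain r where "sublinear r" "r \<le> m" "r (- x) \<le> - m x"
      using sublinear_shrink[OF m(1), of "{x}" "m x"] by auto
    \<comment> \<open>Minimality forces \<open>r = m\<close>.\<close>
    then have "m (- x) \<le> - m x" using min by blast
    then show ?thesis using sublinear_minus[OF m(1), of x] by simp
  qed
  have add: "m (x + y) = m x + m y" for x y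
    using sublinear_add[OF m(1), of x y] sublinear_add[OF m(1), of "- x" "- y"]
      neg[of "x + y"] neg[of x] neg[of y] by simp
  have "linear m"
  proof
    fix t :: real and x
    show "m (t *\<^sub>R x) = t *\<^sub>R m x"
      using sublinear_scaleR[OF m(1), of t x] sublinear_scaleR[OF m(1), of "- t" x] neg[of "t *\<^sub>R x"]
      by (cases "t \<ge> 0") auto
  qed (rule add)
  then show ?thesis using that m(2) by (auto simp: le_fun_def)
qed

text \<open>Hahn--Banach is applied to the norm shrunk along \<open>C\<close>: being below the norm
  bounds \<open>f\<close>, and the values at \<open>- c\<close> force
  \<open>f c \<ge> d\<close>.\<close>

lemma norm_separation:
  fixes C :: "'a::real_normed_vector set"
  assumes C: "convex C" "C \<noteq> {}" and d: "\<And>c. c \<in> C \<Longrightarrow> d \<le> norm c"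
  obtains f :: "'a \<Rightarrow>\<^sub>L real" where "norm f \<le> 1" "\<And>c. c \<in> C \<Longrightarrow> d \<le> f c"
proof -
  have "sublinear (norm :: 'a \<Rightarrow> real)"
    by (auto simp: sublinear_def norm_triangle_ineq)
  then obtain r where r: "sublinear r" "r \<le> norm" "\<And>c. c \<in> C \<Longrightarrow> r (- c) \<le> - d"
    using sublinear_shrink[where q = norm, OF _ C d] by blast
  obtain f where f: "linear f" "\<And>x. f x \<le> r x"
    using hahn_banach_sublinear[OF r(1)] by blast
  have le: "f x \<le> norm x" for x
    using f(2)[of x] r(2) by (meson le_fun_def order_trans)
  have b: "norm (f x) \<le> 1 * norm x" for x
    using le[of x] le[of "- x"] by (simp add: linear_neg[OF f(1)] abs_le_iff)
  have bl: "bounded_linear f"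
    using f(1) b by (intro bounded_linear.intro bounded_linear_axioms.intro exI[of _ 1]) auto
  have "norm (Blinfun f) \<le> 1"
    by (rule norm_blinfun_bound) (use b bl in \<open>simp_all add: bounded_linear_Blinfun_apply\<close>)
  moreover have "d \<le> Blinfun f c" if "c \<in> C" for c
    using f(2)[of "- c"] r(3)[OF that] bl by (simp add: bounded_linear_Blinfun_apply linear_neg[OF f(1)])
  ultimately show ?thesis by (rule that)
qed

lemma norming_functional:
  fixes x :: "'a::real_normed_vector"
  obtains f :: "'a \<Rightarrow>\<^sub>L real" where "norm f \<le> 1" "f x = norm x"
proof -
  obtain f :: "'a \<Rightarrow>\<^sub>L real" where f: "norm f \<le> 1" "norm x \<le> f x"
    using norm_separation[of "{x}" "norm x"] by auto
  have "f x \<le> norm x"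
    using norm_blinfun[of f x] f(1) mult_right_mono[of "norm f" 1 "norm x"] by simp
  then show ?thesis using that f by simp
qed

subsection \<open>Weak topology and classes of operators\<close>

lemma topspace_weak_topology [simp]: "topspace weak_topology = UNIV"
proof -
  have "UNIV \<in> {blinfun_apply f -` U | (f :: 'a \<Rightarrow>\<^sub>L real) U. open U}" by auto
  then show ?thesis
    by (auto simp: weak_topology_def topology_generated_by_topspace)
qed

lemma openin_weak_topology_vimage:
  fixes f :: "'a::real_normed_vector \<Rightarrow>\<^sub>L real"
  shows "open U \<Longrightarrow> openin weak_topology (blinfun_apply f -` U)"
  unfolding weak_topology_def by (rule topology_generated_by_Basis) blast

lemma openin_weak_topology_imp_open: "openin weak_topology U \<Longrightarrow> open U"
proof -
  assume "openin weak_topology U"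
  then have "generate_topology_on {blinfun_apply f -` U | (f :: 'a \<Rightarrow>\<^sub>L real) U. open U} U"
    by (simp add: weak_topology_def openin_topology_generated_by_iff)
  then show "open U"
    by induction (auto intro!: open_vimage simp: blinfun.continuous_on)
qed

text \<open>Mazur's theorem. If the ball of radius \<open>e\<close> around \<open>y\<close> misses
  \<open>C\<close>, the norm is at least \<open>e\<close> on \<open>C\<close> translated by
  \<open>- y\<close>, and \<open>norm_separation\<close> gives a weakly open half-space that
  contains \<open>y\<close> and misses \<open>C\<close>.\<close>

lemma closedin_weak_topology_convex:
  fixes C :: "'a::real_normed_vector set"
  assumes "convex C" "closed C"
  shows "closedin weak_topology C"
proof (cases "C = {}")
  case False
  have "openin weak_topology (- C)"
  proof (subst openin_subopen, intro ballI)
    fix y assume "y \<in> - C"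
    then obtain e where e: "e > 0" "ball y e \<subseteq> - C"
      using assms(2) by (meson closed_def open_contains_ball)
    obtain f :: "'a \<Rightarrow>\<^sub>L real" where f: "\<And>c. c \<in> (\<lambda>x. x - y) ` C \<Longrightarrow> e \<le> f c"
    proof (rule norm_separation[of "(\<lambda>x. x - y) ` C" e])
      show "convex ((\<lambda>x. x - y) ` C)"
        by (rule convex_translation_subtract[OF assms(1)])
      fix c assume "c \<in> (\<lambda>x. x - y) ` C"
      then obtain x where x: "x \<in> C" "c = x - y" by blast
      then have "x \<notin> ball y e" using e by blast
      then show "e \<le> norm c" using x by (simp add: dist_norm norm_minus_commute)
    qed (use False in auto)
    have "openin weak_topology (blinfun_apply f -` {..<f y + e})"
      by (rule openin_weak_topology_vimage) simp
    moreover have "blinfun_apply f -` {..<f y + e} \<subseteq> - C"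
    proof -
      have "f y + e \<le> f x" if "x \<in> C" for x
        using f[of "x - y"] that by (simp add: blinfun.diff_right)
      then show ?thesis by fastforce
    qed
    ultimately show "\<exists>T. openin weak_topology T \<and> y \<in> T \<and> T \<subseteq> - C"
      using e by (intro exI[of _ "blinfun_apply f -` {..<f y + e}"]) auto
  qed
  then show ?thesis by (simp add: closedin_def Compl_eq_Diff_UNIV)
qed simp

text \<open>The norm closure of the image of the ball is weakly compact, since the identity is
  norm-to-weak continuous. It is convex, hence weakly closed by Mazur's theorem, and so contains the
  weak closure.\<close>

lemma compact_operators_subset: "compact_operators \<subseteq> weakly_compact_operators"
proof
  fix T :: "'a \<Rightarrow>\<^sub>L 'a" assume "T \<in> compact_operators"
  define K where "K = closure (blinfun_apply T ` cball 0 1)"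
  have K: "compact K" "convex K" "closed K"
    using \<open>T \<in> compact_operators\<close>
    by (auto simp: K_def compact_operators_def intro!: convex_closure convex_linear_image
        bounded_linear.linear blinfun.bounded_linear_right)
  have "continuous_map euclidean weak_topology (\<lambda>x::'a. x)"
    by (auto simp: continuous_map_def openin_weak_topology_imp_open)
  then have "compactin weak_topology K"
    using image_compactin[of euclidean K weak_topology "\<lambda>x. x"] K by simp
  moreover have "weak_topology closure_of (blinfun_apply T ` cball 0 1) \<subseteq> K"
    using K by (intro closure_of_minimal closedin_weak_topology_convex) (auto simp: K_def closure_subset)
  ultimately show "T \<in> weakly_compact_operators"
    unfolding weakly_compact_operators_def by (auto intro: closed_compactin)
qed

lemma rank_one_operatorE:
  fixes Q :: "'a::real_normed_vector \<Rightarrow>\<^sub>L 'a"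
  assumes "Q \<in> rank_one_operators"
  obtains f :: "'a \<Rightarrow>\<^sub>L real" and z where "norm z = 1" "\<And>x. Q x = f x *\<^sub>R z"
proof -
  have dim1: "dim (range (blinfun_apply Q)) = 1"
    using assms by (simp add: rank_one_operators_def)
  \<comment> \<open>Both the default value of \<open>dim\<close> and the \<open>card\<close> of an
    infinite set are 0, so the value 1 comes from a genuine one-element basis.\<close>
  obtain B where B: "independent B" "span B = span (range (blinfun_apply Q))" "card B = 1"
    using dim1 unfolding dim_def by (metis (mono_tags, lifting) someI_ex zero_neq_one)
  obtain b where b: "B = {b}" using B(3) card_1_singletonE by blast
  have "b \<noteq> 0" using B(1) b by (auto simp: dependent_zero)
  define z where "z = b /\<^sub>R norm b"
  have z: "norm z = 1" "b = norm b *\<^sub>R z" using \<open>b \<noteq> 0\<close> by (auto simp: z_def)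
  \<comment> \<open>As \<open>g z = 1\<close>, the functional \<open>g\<close> reads off the
    coefficient of \<open>z\<close> on the range of \<open>Q\<close>.\<close>
  obtain g :: "'a \<Rightarrow>\<^sub>L real" where g: "g z = norm z" using norming_functional by blast
  have "Q x = (g o\<^sub>L Q) x *\<^sub>R z" for x
  proof -
    have "Q x \<in> span {b}" using B b by (auto intro: span_base)
    then obtain t where "Q x = t *\<^sub>R b" by (auto simp: span_singleton)
    then have "Q x = (t * norm b) *\<^sub>R z" using z(2) by (metis scaleR_scaleR)
    then show ?thesis using g z(1) by (simp add: blinfun.scaleR_right)
  qed
  then show ?thesis using that z(1) by blast
qed

lemma rank_one_operatorI:
  fixes Q :: "'a::real_normed_vector \<Rightarrow>\<^sub>L 'a"
  assumes "\<And>x. Q x = blinfun_apply f x *\<^sub>R z" "f \<noteq> 0" "z \<noteq> 0"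
  shows "Q \<in> rank_one_operators"
proof -
  obtain x where x: "f x \<noteq> 0" using assms(2) by (metis blinfun_eqI zero_blinfun.rep_eq)
  have "range (blinfun_apply Q) = span {z}"
  proof (intro equalityI subsetI)
    fix y assume "y \<in> span {z}"
    then obtain t where "y = t *\<^sub>R z" by (auto simp: span_singleton)
    then have "y = Q ((t / f x) *\<^sub>R x)" using x by (simp add: assms(1) blinfun.scaleR_right)
    then show "y \<in> range (blinfun_apply Q)" by blast
  qed (auto simp: assms(1) span_singleton)
  then show ?thesis
    using assms(3) dim_eq_card_independent[of "{z}"] by (simp add: rank_one_operators_def)
qed

lemma rank_one_operators_subset: "rank_one_operators \<subseteq> compact_operators"
proof
  fix Q :: "'a \<Rightarrow>\<^sub>L 'a" assume "Q \<in> rank_one_operators"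
  then obtain f :: "'a \<Rightarrow>\<^sub>L real" and z where Q: "\<And>x. Q x = f x *\<^sub>R z"
    using rank_one_operatorE by metis
  define K where "K = (\<lambda>t. t *\<^sub>R z) ` cball 0 (norm f)"
  have K: "compact K"
    unfolding K_def by (intro compact_continuous_image continuous_intros compact_cball)
  have "norm (f x) \<le> norm f" if "norm x \<le> 1" for x
    using norm_blinfun[of f x] mult_left_mono[OF that, of "norm f"] by simp
  then have "blinfun_apply Q ` cball 0 1 \<subseteq> K"
    by (auto simp: K_def Q)
  then have "closure (blinfun_apply Q ` cball 0 1) \<subseteq> K"
    by (intro closure_minimal compact_imp_closed K)
  then show "Q \<in> compact_operators"
    using compact_Int_closed[OF K closed_closure, of "blinfun_apply Q ` cball 0 1"]
    by (simp add: compact_operators_def inf.absorb2)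
qed

subsection \<open>Slices under the Daugavet property\<close>

lemma abs_blinfun_le:
  fixes f :: "'a::real_normed_vector \<Rightarrow>\<^sub>L real"
  assumes "norm f \<le> 1"
  shows "\<bar>f x\<bar> \<le> norm x"
  using norm_blinfun[of f x] assms mult_right_mono[of "norm f" 1 "norm x"] by simp

text \<open>The point is taken in the open ball because \<open>norming\<close> supplies preimages
  there.\<close>

lemma less_norm_blinfunE:
  fixes T :: "'a::real_normed_vector \<Rightarrow>\<^sub>L 'b::real_normed_vector"
  assumes "r < norm T"
  obtains x where "x \<in> ball 0 1" "r < norm (T x)"
proof (cases "r < 0")
  case True
  then show ?thesis using that[of 0] by simp
next
  case False
  have "\<exists>x\<in>ball 0 1. r < norm (T x)"
  proof (rule ccontr)
    assume "\<not> ?thesis"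
    then have le: "norm (T x) \<le> r" if "norm x < 1" for x using that by (force simp: not_less)
    have "norm (T x) \<le> r * norm x" for x
    proof (cases "x = 0")
      case False
      show ?thesis
      proof (rule field_le_mult_one_interval)
        fix t :: real assume t: "0 < t" "t < 1"
        have "norm (T ((t / norm x) *\<^sub>R x)) \<le> r" using False t by (intro le) simp
        then show "t * norm (T x) \<le> r * norm x"
          using False t by (simp add: blinfun.scaleR_right field_simps)
      qed
    qed (simp add: blinfun.zero_right)
    then have "norm T \<le> r" using \<open>\<not> r < 0\<close> by (intro norm_blinfun_bound) auto
    then show False using assms by simp
  qed
  then show ?thesis using that by blast
qed

lemma norm_rank_one_blinfun:
  fixes Q :: "'a::real_normed_vector \<Rightarrow>\<^sub>L 'b::real_normed_vector"
  assumes "\<And>x. Q x = blinfun_apply f x *\<^sub>R z" "norm z = 1"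
  shows "norm Q = norm f"
proof (rule antisym)
  show "norm Q \<le> norm f"
    using norm_blinfun[of f] by (intro norm_blinfun_bound) (auto simp: assms)
  show "norm f \<le> norm Q"
    using norm_blinfun[of Q] by (intro norm_blinfun_bound) (auto simp: assms)
qed

lemma norm_id_add_le: "norm (id_blinfun + T) \<le> 1 + norm (T :: 'a::real_normed_vector \<Rightarrow>\<^sub>L 'a)"
  using norm_triangle_ineq[of id_blinfun T] norm_blinfun_id_le[where 'a = 'a] by simp

text \<open>Two vectors of the unit ball whose sum has norm almost 2 span an almost isometric copy
  of the positive cone of \<open>\<ell>\<^sub>1\<close>. For \<open>b \<le> a\<close> this follows
  from writing \<open>a *\<^sub>R (z + x)\<close> as \<open>a *\<^sub>R z + b *\<^sub>R x\<close>
  plus a multiple of \<open>x\<close>.\<close>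

lemma norm_add_scaled_ge:
  assumes zx: "norm z \<le> 1" "norm x \<le> 1" "norm (z + x) \<ge> 2 - \<eta>"
    and ab: "0 \<le> a" "a \<le> M" "0 \<le> b" "b \<le> M" and "0 \<le> \<eta>"
  shows "norm (a *\<^sub>R z + b *\<^sub>R x) \<ge> a + b - M * \<eta>"
proof -
  have *: "norm (a *\<^sub>R z + b *\<^sub>R x) \<ge> a + b - M * \<eta>"
    if "norm x \<le> 1" "norm (z + x) \<ge> 2 - \<eta>" "0 \<le> b" "b \<le> a" "a \<le> M"
    for a b and z x :: 'a
  proof -
    have "a * (2 - \<eta>) \<le> norm (a *\<^sub>R (z + x))"
      using that by (simp add: mult_left_mono)
    also have "a *\<^sub>R (z + x) = (a *\<^sub>R z + b *\<^sub>R x) + (a - b) *\<^sub>R x"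
      by (simp add: algebra_simps)
    also have "norm \<dots> \<le> norm (a *\<^sub>R z + b *\<^sub>R x) + (a - b) * norm x"
      using that by (metis abs_of_nonneg diff_ge_0_iff_ge norm_scaleR norm_triangle_ineq)
    also have "(a - b) * norm x \<le> a - b"
      using that by (intro mult_left_le) auto
    also have "M * \<eta> \<ge> a * \<eta>" using that \<open>0 \<le> \<eta>\<close> by (intro mult_right_mono)
    ultimately show ?thesis by (simp add: algebra_simps)
  qed
  show ?thesis
  proof (cases "b \<le> a")
    case True
    then show ?thesis using * zx ab by blast
  next
    case False
    then have "norm (b *\<^sub>R x + a *\<^sub>R z) \<ge> b + a - M * \<eta>"
      using * zx ab by (simp add: add.commute)
    then show ?thesis by (simp add: add.commute)
  qed
qed

text \<open>Neither \<open>h\<close> nor \<open>c\<close> is normalised, so a sum of two functionals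
  defines a slice directly; nonemptiness is assumed separately. The open ball matches the preimages
  given by \<open>norming\<close>.\<close>

definition open_slice :: "('a::real_normed_vector \<Rightarrow>\<^sub>L real) \<Rightarrow> real \<Rightarrow> 'a set"
  where "open_slice h c = {x \<in> ball 0 1. h x > c}"

text \<open>If \<open>f\<close> is the functional of the slice and \<open>g\<close> norms \<open>x + f x *\<^sub>R z\<close>, whose norm is close
  to 2, then \<open>g x\<close>, \<open>f x\<close> and \<open>g z\<close> are all close to 1, so a slice given by \<open>f + g\<close> works.\<close>

lemma daugavet_property_slice:
  fixes z :: "'a::real_normed_vector"
  assumes D: "daugavet_property TYPE('a)" and z: "norm z = 1" and "\<epsilon> > 0"
    and ne: "open_slice h c \<noteq> {}"
  obtains h' c' where "open_slice h' c' \<noteq> {}" "open_slice h' c' \<subseteq> open_slice h c"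
    "\<And>x. x \<in> open_slice h' c' \<Longrightarrow> norm (z + x) > 2 - \<epsilon>"
proof -
  \<comment> \<open>The slice is first given a functional of norm one. If \<open>h = 0\<close> it is
    the whole open ball, and the slice of any such functional lies in it.\<close>
  obtain f k where fk: "norm f = 1" "k < 1" "open_slice f k \<subseteq> open_slice h c"
  proof (cases "h = 0")
    case True
    obtain f :: "'a \<Rightarrow>\<^sub>L real" where f: "norm f \<le> 1" "f z = norm z"
      by (rule norming_functional)
    have "norm f = 1" using f z norm_blinfun[of f z] by simp
    moreover have "open_slice f 0 \<subseteq> open_slice h c"
      using ne by (auto simp: open_slice_def True)
    ultimately show ?thesis using that[of f 0] by simp
  next
    case False
    obtain x where x: "norm x < 1" "c < h x" using ne by (auto simp: open_slice_def)
    have "h x \<le> norm h * norm x" using norm_blinfun[of h x] by simp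
    also have "\<dots> \<le> norm h" using x by (intro mult_left_le) auto
    finally have "c / norm h < 1" using x False by (simp add: field_simps)
    moreover have "open_slice (h /\<^sub>R norm h) (c / norm h) \<subseteq> open_slice h c"
      using False by (auto simp: open_slice_def blinfun.scaleR_left field_simps)
    ultimately show ?thesis using that[of "h /\<^sub>R norm h" "c / norm h"] False by simp
  qed
  \<comment> \<open>The bound \<open>1 / 2\<close> makes \<open>g z\<close> nonnegative,
    \<open>\<epsilon> / 3\<close> gives the final norm estimate, and \<open>(1 - k) / 2\<close>
    keeps the new slice inside the old one.\<close>
  define \<eta> where "\<eta> = min (1 / 2) (min (\<epsilon> / 3) ((1 - k) / 2))"
  have \<eta>: "0 < \<eta>" "\<eta> \<le> 1 / 2" "3 * \<eta> \<le> \<epsilon>" "2 * \<eta> \<le> 1 - k"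
    using fk \<open>\<epsilon> > 0\<close> by (auto simp: \<eta>_def min_def field_simps)
  define Q where "Q = blinfun_scaleR_left z o\<^sub>L f"
  have Q: "Q x = f x *\<^sub>R z" for x by (simp add: Q_def)
  have "Q \<in> rank_one_operators" using fk z by (intro rank_one_operatorI[OF Q]) auto
  then have "norm (id_blinfun + Q) = 2"
    using D norm_rank_one_blinfun[OF Q z] fk by (simp add: daugavet_property_def)
  then obtain x0 where x0: "x0 \<in> ball 0 1" "2 - \<eta> < norm (x0 + f x0 *\<^sub>R z)"
    using less_norm_blinfunE[of "2 - \<eta>" "id_blinfun + Q"] \<eta>(1)
    by (auto simp: blinfun.add_left Q)
  \<comment> \<open>Passing to \<open>- x0\<close> if necessary makes \<open>f x\<close> nonnegative
    without changing the norm of \<open>x + f x *\<^sub>R z\<close>.\<close>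
  define x where "x = (if f x0 \<ge> 0 then x0 else - x0)"
  have "norm (- x0 - f x0 *\<^sub>R z) = norm (x0 + f x0 *\<^sub>R z)"
    using norm_minus_cancel[of "x0 + f x0 *\<^sub>R z"] by simp
  then have x: "norm x < 1" "2 - \<eta> < norm (x + f x *\<^sub>R z)" "f x \<ge> 0"
    using x0 by (auto simp: x_def blinfun.minus_right)
  obtain g :: "'a \<Rightarrow>\<^sub>L real" where g: "norm g \<le> 1" "g (x + f x *\<^sub>R z) = norm (x + f x *\<^sub>R z)"
    by (rule norming_functional)
  have bounds: "f w < 1" "g w < 1" if "norm w < 1" for w
    using abs_blinfun_le[of f w] abs_blinfun_le[of g w] fk g that by auto
  have gz: "g z \<le> 1" using abs_blinfun_le[OF g(1), of z] z by simp
  have 1: "g x + f x * g z > 2 - \<eta>"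
    using g(2) x(2) by (simp add: blinfun.add_right blinfun.scaleR_right)
  have 2: "f x * g z \<le> f x" using gz x(3) by (intro mult_left_le)
  have gz0: "g z \<ge> 0"
    using 1 x(3) bounds[OF x(1)] \<eta>(2) mult_nonneg_nonpos[of "f x" "g z"] by linarith
  have 3: "f x * g z \<le> g z" using bounds[OF x(1)] x(3) gz0 by (intro mult_left_le_one_le) auto
  have gt: "g x > 1 - \<eta>" "f x > 1 - \<eta>" "g z > 1 - \<eta>"
    using 1 2 3 bounds[OF x(1)] by linarith+
  show ?thesis
  proof (rule that)
    show "open_slice (f + g) (2 - 2 * \<eta>) \<noteq> {}"
      using x(1) gt by (auto simp: open_slice_def blinfun.add_left intro!: exI[of _ x])
    \<comment> \<open>Each of the two values is below 1 while their sum exceeds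
      \<open>2 - 2 * \<eta>\<close>.\<close>
    have w: "f w > 1 - 2 * \<eta> \<and> g w > 1 - 2 * \<eta> \<and> norm w < 1"
      if "w \<in> open_slice (f + g) (2 - 2 * \<eta>)" for w
      using that bounds[of w] by (auto simp: open_slice_def blinfun.add_left)
    show "open_slice (f + g) (2 - 2 * \<eta>) \<subseteq> open_slice h c"
    proof
      fix w assume "w \<in> open_slice (f + g) (2 - 2 * \<eta>)"
      from w[OF this] \<eta>(4) have "w \<in> open_slice f k" by (simp add: open_slice_def)
      then show "w \<in> open_slice h c" using fk by blast
    qed
    show "norm (z + x) > 2 - \<epsilon>" if "x \<in> open_slice (f + g) (2 - 2 * \<eta>)" for x
      using w[OF that] gt(3) abs_blinfun_le[OF g(1), of "z + x"] \<eta>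
      by (simp add: blinfun.add_right)
  qed
qed

text \<open>The slice is shrunk once for each vector of \<open>F\<close>; estimates already obtained
  survive on a smaller slice.\<close>

lemma daugavet_property_slice_finite:
  fixes F :: "'a::real_normed_vector set"
  assumes D: "daugavet_property TYPE('a)" and "finite F" "F \<subseteq> sphere 0 1" and "\<epsilon> > 0"
    and "open_slice h c \<noteq> {}"
  shows "\<exists>h' c'. open_slice h' c' \<noteq> {} \<and> open_slice h' c' \<subseteq> open_slice h c \<and>
    (\<forall>x\<in>open_slice h' c'. \<forall>z\<in>F. norm (z + x) > 2 - \<epsilon>)"
  using assms(2,3)
proof (induction F)
  case empty
  then show ?case using assms(5) by blast
next
  case (insert z F)
  then obtain h1 c1 where 1: "open_slice h1 c1 \<noteq> {}" "open_slice h1 c1 \<subseteq> open_slice h c"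
    "\<And>x y. x \<in> open_slice h1 c1 \<Longrightarrow> y \<in> F \<Longrightarrow> norm (y + x) > 2 - \<epsilon>" by blast
  have "norm z = 1" using insert.prems by simp
  obtain h2 c2 where 2: "open_slice h2 c2 \<noteq> {}" "open_slice h2 c2 \<subseteq> open_slice h1 c1"
    "\<And>x. x \<in> open_slice h2 c2 \<Longrightarrow> norm (z + x) > 2 - \<epsilon>"
    using daugavet_property_slice[OF D \<open>norm z = 1\<close> \<open>\<epsilon> > 0\<close> 1(1)] by metis
  show ?case using 1 2 by (intro exI[of _ h2] exI[of _ c2]) blast
qed

text \<open>A finite net of \<open>W\<close> reduces the claim to finitely many directions;
  \<open>norm_add_scaled_ge\<close> then passes from unit vectors to multiples.\<close>

lemma daugavet_property_compact:
  fixes W :: "'a::real_normed_vector set"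
  assumes D: "daugavet_property TYPE('a)" and W: "compact W" and "\<epsilon> > 0"
    and ne: "open_slice h c \<noteq> {}" and nontriv: "\<exists>v::'a. v \<noteq> 0"
  obtains x where "x \<in> open_slice h c"
    "\<And>w t. w \<in> W \<Longrightarrow> 0 \<le> t \<Longrightarrow> t \<le> 1 \<Longrightarrow> norm (w + t *\<^sub>R x) \<ge> norm w + t - \<epsilon>"
proof -
  obtain N where N: "finite N" "W \<subseteq> (\<Union>w\<in>N. ball w (\<epsilon> / 4))"
    using W \<open>\<epsilon> > 0\<close> compact_eq_totally_bounded[of W] by (meson divide_pos_pos zero_less_numeral)
  obtain M where M: "M \<ge> 1" "\<And>w. w \<in> N \<Longrightarrow> norm w \<le> M"
  proof (rule that)
    show "norm w \<le> Max (insert 1 (norm ` N))" if "w \<in> N" for w using that N by (intro Max_ge) auto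
  qed (use N in \<open>auto intro: Max_ge\<close>)
  obtain v :: 'a where v: "norm v = 1"
    using nontriv by (metis norm_sgn)
  \<comment> \<open>The zero vector has no direction, so an arbitrary unit vector \<open>v\<close>
    stands in for it.\<close>
  define u where "u = (\<lambda>w::'a. if w = 0 then v else sgn w)"
  have u: "norm (u w) = 1" "w = norm w *\<^sub>R u w" for w
    using v by (auto simp: u_def norm_sgn sgn_div_norm)
  have "u ` N \<subseteq> sphere 0 1" using u(1) by auto
  moreover have "\<epsilon> / (2 * M) > 0" using \<open>\<epsilon> > 0\<close> M(1) by simp
  ultimately have "\<exists>h' c'. open_slice h' c' \<noteq> {} \<and> open_slice h' c' \<subseteq> open_slice h c \<and>
      (\<forall>x\<in>open_slice h' c'. \<forall>z\<in>u ` N. norm (z + x) > 2 - \<epsilon> / (2 * M))"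
    by (intro daugavet_property_slice_finite[OF D finite_imageI[OF N(1)] _ _ ne])
  then obtain h' c' where "open_slice h' c' \<noteq> {}" and h': "open_slice h' c' \<subseteq> open_slice h c"
    "\<And>x w. x \<in> open_slice h' c' \<Longrightarrow> w \<in> N \<Longrightarrow> norm (u w + x) > 2 - \<epsilon> / (2 * M)"
    by blast
  then obtain x where x: "x \<in> open_slice h' c'" by blast
  show ?thesis
  proof (rule that)
    show "x \<in> open_slice h c" using x h' by blast
    have x1: "norm x \<le> 1" using x by (simp add: open_slice_def)
    fix w and t :: real assume w: "w \<in> W" and t: "0 \<le> t" "t \<le> 1"
    then obtain w' where w': "w' \<in> N" "norm (w' - w) < \<epsilon> / 4"
      using N(2) by (auto simp: dist_norm)
    \<comment> \<open>The scaled estimate costs \<open>\<epsilon> / 2\<close>; replacing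
      \<open>w'\<close> by \<open>w\<close> costs \<open>\<epsilon> / 4\<close> on each
      side.\<close>
    have "norm w' + t - M * (\<epsilon> / (2 * M)) \<le> norm (norm w' *\<^sub>R u w' + t *\<^sub>R x)"
      using u(1)[of w'] x1 h'(2)[OF x w'(1)] M w' t \<open>\<epsilon> > 0\<close> by (intro norm_add_scaled_ge) auto
    also have "norm w' *\<^sub>R u w' = w'" by (rule u(2)[symmetric])
    also have "norm (w' + t *\<^sub>R x) \<le> norm (w + t *\<^sub>R x) + norm (w' - w)"
      using norm_triangle_ineq[of "w + t *\<^sub>R x" "w' - w"] by (simp add: algebra_simps)
    also have "M * (\<epsilon> / (2 * M)) = \<epsilon> / 2" using M by simp
    finally show "norm (w + t *\<^sub>R x) \<ge> norm w + t - \<epsilon>"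
      using w'(2) norm_triangle_ineq2[of w w'] by (simp add: norm_minus_commute)
  qed
qed

text \<open>The closed hulls decrease with \<open>m\<close> and are weakly closed by Mazur's
  theorem, so the finite intersection property in the weakly compact closure of the image
  applies.\<close>

lemma weakly_compact_convex_hull_tails:
  fixes T :: "'a::real_normed_vector \<Rightarrow>\<^sub>L 'a" and x :: "nat \<Rightarrow> 'a"
  assumes T: "T \<in> weakly_compact_operators" and x: "\<And>n. norm (x n) \<le> 1"
  obtains y where "\<And>m. y \<in> closure (convex hull ((\<lambda>n. T (x n)) ` {m..}))"
proof -
  let ?K = "weak_topology closure_of (blinfun_apply T ` cball 0 1)"
  define D where "D = (\<lambda>m. closure (convex hull ((\<lambda>n. T (x n)) ` {m..})))"
  have TK: "T (x n) \<in> ?K" for n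
    using x closure_of_subset[of "blinfun_apply T ` cball 0 1" weak_topology] by auto
  have TD: "T (x n) \<in> D m" if "m \<le> n" for m n
    unfolding D_def using that by (intro closure_subset[THEN subsetD] hull_inc) auto
  have "compactin weak_topology ?K" using T by (simp add: weakly_compact_operators_def)
  then have "?K \<inter> \<Inter>(range D) \<noteq> {}"
    unfolding compactin_fip
  proof (elim conjE allE[of _ "range D"] impE)
    have "closedin weak_topology C" if "C \<in> range D" for C
      using that by (auto simp: D_def intro!: closedin_weak_topology_convex convex_closure)
    moreover have "?K \<inter> \<Inter>F \<noteq> {}" if F: "finite F" "F \<subseteq> range D" for F
    proof -
      obtain I where I: "finite I" "F = D ` I" using finite_subset_image[OF F] by blast
      \<comment> \<open>Inserting 0 gives the maximum a meaning when \<open>I\<close> is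
        empty.\<close>
      have "T (x (Max (insert 0 I))) \<in> ?K \<inter> \<Inter>F"
        using TK TD I by (auto intro!: TD Max_ge)
      then show ?thesis by blast
    qed
    ultimately show "(\<forall>C\<in>range D. closedin weak_topology C) \<and>
      (\<forall>F. finite F \<and> F \<subseteq> range D \<longrightarrow> ?K \<inter> \<Inter>F \<noteq> {})" by blast
  qed
  then show ?thesis using that by (auto simp: D_def)
qed

text \<open>The hulls of the finite segments increase with \<open>p\<close>, so their union is
  convex and contains the whole hull.\<close>

lemma convex_hull_image_atLeast:
  fixes f :: "nat \<Rightarrow> 'a::real_vector"
  assumes "u \<in> convex hull (f ` {m..})"
  obtains p where "m < p" "u \<in> convex hull (f ` {m..<p})"
proof -
  let ?U = "\<Union>p\<in>{m<..}. convex hull (f ` {m..<p})"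
  have mono: "convex hull (f ` {m..<p}) \<subseteq> convex hull (f ` {m..<max p q})"
    "convex hull (f ` {m..<q}) \<subseteq> convex hull (f ` {m..<max p q})" for p q
    by (auto intro!: hull_mono image_mono)
  have "convex hull (f ` {m..}) \<subseteq> ?U"
  proof (rule hull_minimal)
    show "f ` {m..} \<subseteq> ?U"
    proof
      fix y assume "y \<in> f ` {m..}"
      then obtain n where "m \<le> n" "y = f n" by auto
      then show "y \<in> ?U" by (intro UN_I[of "Suc n"] hull_inc) auto
    qed
    show "convex ?U"
    proof (rule convexI)
      fix x y and s t :: real
      assume "x \<in> ?U" "y \<in> ?U" and st: "0 \<le> s" "0 \<le> t" "s + t = 1"
      then obtain p q where pq: "m < p" "x \<in> convex hull (f ` {m..<p})" "y \<in> convex hull (f ` {m..<q})"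
        by blast
      then have "x \<in> convex hull (f ` {m..<max p q})" "y \<in> convex hull (f ` {m..<max p q})"
        using mono by blast+
      then have "s *\<^sub>R x + t *\<^sub>R y \<in> convex hull (f ` {m..<max p q})"
        using st by (intro convexD[OF convex_convex_hull])
      then show "s *\<^sub>R x + t *\<^sub>R y \<in> ?U" using pq by (intro UN_I[of "max p q"]) auto
    qed
  qed
  then show ?thesis using assms that by blast
qed

text \<open>Each term comes from \<open>daugavet_property_compact\<close>, applied to the sum of two
  hulls of finite sets, which is compact. The errors sum to at most \<open>\<delta>\<close>. The
  point 0 in the second hull admits combinations of total weight below 1.\<close>

lemma daugavet_property_sequence:
  fixes T :: "'a::real_normed_vector \<Rightarrow>\<^sub>L 'a"
  assumes D: "daugavet_property TYPE('a)" and "\<delta> > 0"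
    and ne: "open_slice h c \<noteq> {}" and nontriv: "\<exists>v::'a. v \<noteq> 0"
  obtains x :: "nat \<Rightarrow> 'a" where "\<And>n. x n \<in> open_slice h c"
    "\<And>n u v t. u \<in> convex hull ((\<lambda>i. T (x i)) ` {..<n}) \<Longrightarrow> v \<in> convex hull (insert 0 (x ` {..<n})) \<Longrightarrow>
       0 \<le> t \<Longrightarrow> t \<le> 1 \<Longrightarrow> norm (u + v + t *\<^sub>R x n) \<ge> norm (u + v) + t - \<delta> * (1 / 2) ^ Suc n"
proof -
  define P where "P = (\<lambda>(x :: nat \<Rightarrow> 'a) n y. y \<in> open_slice h c \<and>
    (\<forall>u v t. u \<in> convex hull ((\<lambda>i. T (x i)) ` {..<n}) \<longrightarrow> v \<in> convex hull (insert 0 (x ` {..<n})) \<longrightarrow>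
       0 \<le> t \<longrightarrow> t \<le> 1 \<longrightarrow> norm (u + v + t *\<^sub>R y) \<ge> norm (u + v) + t - \<delta> * (1 / 2) ^ Suc n))"
  have "\<exists>x. \<forall>n. P x n (x n)"
  \<comment> \<open>The recursion requires that \<open>P x n\<close> depend on \<open>x\<close> only
    through its values below \<open>n\<close>.\<close>
  proof (rule dependent_wellorder_choice)
    fix r n and x x' :: "nat \<Rightarrow> 'a" assume "\<And>i. i < n \<Longrightarrow> x i = x' i"
    then have "x ` {..<n} = x' ` {..<n}" "(\<lambda>i. T (x i)) ` {..<n} = (\<lambda>i. T (x' i)) ` {..<n}"
      by (auto intro!: image_cong)
    then show "P x n r = P x' n r" by (simp add: P_def)
  next
    fix n and x :: "nat \<Rightarrow> 'a"
    let ?W = "{u + v | u v. u \<in> convex hull ((\<lambda>i. T (x i)) ` {..<n}) \<and> v \<in> convex hull (insert 0 (x ` {..<n}))}"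
    have W: "compact ?W"
      by (intro compact_sums finite_imp_compact_convex_hull) auto
    have pos: "\<delta> * (1 / 2) ^ Suc n > 0" using \<open>\<delta> > 0\<close> by simp
    obtain y where y: "y \<in> open_slice h c"
      "\<And>w t. w \<in> ?W \<Longrightarrow> 0 \<le> t \<Longrightarrow> t \<le> 1 \<Longrightarrow> norm (w + t *\<^sub>R y) \<ge> norm w + t - \<delta> * (1 / 2) ^ Suc n"
      by (rule daugavet_property_compact[OF D W pos ne nontriv]) blast
    have "P x n y"
      unfolding P_def
    proof (intro conjI allI impI)
      fix u v and t :: real
      assume "u \<in> convex hull ((\<lambda>i. T (x i)) ` {..<n})" "v \<in> convex hull (insert 0 (x ` {..<n}))"
        "0 \<le> t" "t \<le> 1"
      then show "norm (u + v + t *\<^sub>R y) \<ge> norm (u + v) + t - \<delta> * (1 / 2) ^ Suc n"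
        by (intro y(2)) auto
    qed (rule y(1))
    then show "\<exists>r. P x n r" ..
  qed
  then obtain x where "\<And>n. P x n (x n)" by blast
  then show ?thesis by (intro that[of x]) (simp_all add: P_def)
qed

subsection \<open>The Daugavet equation for weakly compact operators\<close>

theorem daugavet_equation_weakly_compact:
  fixes T :: "'a::real_normed_vector \<Rightarrow>\<^sub>L 'a"
  assumes D: "daugavet_property TYPE('a)" and nontriv: "\<exists>v::'a. v \<noteq> 0"
    and T: "T \<in> weakly_compact_operators"
  shows "norm (id_blinfun + T) = 1 + norm T"
proof (rule antisym[OF norm_id_add_le], rule field_le_epsilon)
  fix e :: real assume "e > 0"
  \<comment> \<open>One \<open>\<delta>\<close> is spent on the summed errors, two on the distance
    from \<open>u\<close> to \<open>v\<close>, and one on the slice.\<close>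
  define \<delta> where "\<delta> = e / 4"
  have "\<delta> > 0" using \<open>e > 0\<close> by (simp add: \<delta>_def)
  obtain x0 where x0: "x0 \<in> ball 0 1" "norm T - \<delta> < norm (T x0)"
    using less_norm_blinfunE[of "norm T - \<delta>" T] \<open>\<delta> > 0\<close> by auto
  obtain f :: "'a \<Rightarrow>\<^sub>L real" where f: "norm f \<le> 1" "f (T x0) = norm (T x0)"
    by (rule norming_functional)
  let ?S = "open_slice (f o\<^sub>L T) (norm T - \<delta>)"
  have S: "?S \<noteq> {}" using x0 f by (auto simp: open_slice_def)
  obtain x where xS: "\<And>n. x n \<in> ?S" and
    x: "\<And>n u v t. u \<in> convex hull ((\<lambda>i. T (x i)) ` {..<n}) \<Longrightarrow> v \<in> convex hull (insert 0 (x ` {..<n})) \<Longrightarrow>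
       0 \<le> t \<Longrightarrow> t \<le> 1 \<Longrightarrow> norm (u + v + t *\<^sub>R x n) \<ge> norm (u + v) + t - \<delta> * (1 / 2) ^ Suc n"
    by (rule daugavet_property_sequence[where T = T, OF D \<open>\<delta> > 0\<close> S nontriv]) blast
  have x1: "norm (x n) \<le> 1" and fx: "f (T (x n)) > norm T - \<delta>" for n
    using xS[of n] by (auto simp: open_slice_def)
  obtain y where y: "\<And>m. y \<in> closure (convex hull ((\<lambda>n. T (x n)) ` {m..}))"
    by (rule weakly_compact_convex_hull_tails[where x = x, OF T x1]) blast
  obtain u where u: "u \<in> convex hull ((\<lambda>n. T (x n)) ` {0..})" "dist u y < \<delta>"
    using y[of 0] \<open>\<delta> > 0\<close> unfolding closure_approachable by blast
  obtain m where m: "u \<in> convex hull ((\<lambda>n. T (x n)) ` {0..<m})"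
    using convex_hull_image_atLeast[OF u(1)] by blast
  obtain v where v: "v \<in> convex hull ((\<lambda>n. T (x n)) ` {m..})" "dist v y < \<delta>"
    using y[of m] \<open>\<delta> > 0\<close> unfolding closure_approachable by blast
  obtain p where p: "m < p" "v \<in> convex hull ((\<lambda>n. T (x n)) ` {m..<p})"
    using convex_hull_image_atLeast[OF v(1)] by blast
  have "convex hull ((\<lambda>n. T (x n)) ` {m..<p}) = T ` (convex hull (x ` {m..<p}))"
    by (simp add: convex_hull_linear_image image_image bounded_linear.linear blinfun.bounded_linear_right)
  then obtain b where b: "b \<in> convex hull (x ` {m..<p})" "v = T b" using p by blast
  \<comment> \<open>The terms of \<open>b\<close> are split off from the last one downwards. The
    scalar \<open>s\<close> is general because the remaining combination carries only part of the
    weight.\<close>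
  have key: "norm (u + s *\<^sub>R b) \<ge> norm u + s - (\<Sum>i\<in>{m..<p}. \<delta> * (1 / 2) ^ Suc i)"
    if "b \<in> convex hull (x ` {m..<p})" "0 \<le> s" "s \<le> 1" for b s p
    using that
  proof (induction p arbitrary: b s)
    case 0
    then show ?case by simp
  next
    case (Suc p)
    have "m \<le> p" using Suc.prems(1) by (cases "m \<le> p") auto
    have "convex hull ((\<lambda>n. T (x n)) ` {0..<m}) \<subseteq> convex hull ((\<lambda>n. T (x n)) ` {..<p})"
      using \<open>m \<le> p\<close> by (intro hull_mono image_mono) auto
    then have um: "u \<in> convex hull ((\<lambda>n. T (x n)) ` {..<p})" using m by blast
    have *: "b \<in> convex hull (insert (x p) (x ` {m..<p}))"
      using Suc.prems(1) \<open>m \<le> p\<close> by (simp add: atLeastLessThanSuc)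
    show ?case
    proof (cases "m = p")
      case True
      then have "b = x p" using * by simp
      then show ?thesis
        using x[OF um, of 0 s] Suc.prems True by (simp add: hull_inc)
    next
      case False
      then obtain t b' where b': "0 \<le> t" "t \<le> 1" "b' \<in> convex hull (x ` {m..<p})"
        "b = (1 - t) *\<^sub>R x p + t *\<^sub>R b'"
        using * \<open>m \<le> p\<close> by (auto simp: convex_hull_insert_alt split: if_splits)
      have st: "0 \<le> s * t" "s * t \<le> 1" "0 \<le> s * (1 - t)" "s * (1 - t) \<le> 1"
        using Suc.prems b' by (auto intro: mult_le_one)
      have "convex hull (x ` {m..<p}) \<subseteq> convex hull (insert 0 (x ` {..<p}))"
        by (intro hull_mono) auto
      then have "b' \<in> convex hull (insert 0 (x ` {..<p}))" using b'(3) by blast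
      \<comment> \<open>The point 0 absorbs the missing weight \<open>1 - s * t\<close>.\<close>
      then have v': "(s * t) *\<^sub>R b' + (1 - s * t) *\<^sub>R 0 \<in> convex hull (insert 0 (x ` {..<p}))"
        using st by (intro convexD[OF convex_convex_hull]) (auto simp: hull_inc)
      have "norm u + s * t - (\<Sum>i\<in>{m..<p}. \<delta> * (1 / 2) ^ Suc i) \<le> norm (u + (s * t) *\<^sub>R b')"
        using Suc.IH[OF b'(3) st(1,2)] .
      moreover have "norm (u + (s * t) *\<^sub>R b') + s * (1 - t) - \<delta> * (1 / 2) ^ Suc p
          \<le> norm (u + (s * t) *\<^sub>R b' + (s * (1 - t)) *\<^sub>R x p)"
        using x[OF um v' st(3,4)] by simp
      moreover have "u + (s * t) *\<^sub>R b' + (s * (1 - t)) *\<^sub>R x p = u + s *\<^sub>R b"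
        by (simp add: b' scaleR_add_right)
      ultimately show ?thesis using \<open>m \<le> p\<close> by (simp add: algebra_simps)
    qed
  qed
  have "(\<Sum>i\<in>{m..<p}. (1 / 2) ^ Suc i) \<le> (\<Sum>i. (1 / 2 :: real) ^ Suc i)"
    by (intro sum_le_suminf sums_summable[OF power_half_series]) auto
  also have "\<dots> = 1" using power_half_series by (simp add: sums_iff)
  finally have "\<delta> * (\<Sum>i\<in>{m..<p}. (1 / 2) ^ Suc i) \<le> \<delta>"
    using \<open>\<delta> > 0\<close> by (intro mult_left_le) auto
  then have "(\<Sum>i\<in>{m..<p}. \<delta> * (1 / 2) ^ Suc i) \<le> \<delta>"
    by (simp only: sum_distrib_left)
  then have "norm u + 1 - \<delta> \<le> norm (u + b)"
    using key[OF b(1), of 1] by simp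
  \<comment> \<open>Since \<open>v = T b\<close>, the vectors \<open>u + b\<close> and
    \<open>b + T b\<close> differ by \<open>u - v\<close>.\<close>
  also have "\<dots> \<le> norm (b + T b) + norm (u - v)"
    using norm_triangle_ineq[of "b + T b" "u - v"] by (simp add: b algebra_simps)
  also have "norm (u - v) < 2 * \<delta>"
    using u(2) v(2) dist_triangle2[of u v y] by (simp add: dist_norm)
  also have "norm (b + T b) \<le> norm (id_blinfun + T)"
  proof -
    have "convex hull (x ` {m..<p}) \<subseteq> cball 0 1"
      using x1 by (intro hull_minimal) auto
    then have "norm b \<le> 1" using b by auto
    then show ?thesis
      using norm_blinfun[of "id_blinfun + T" b] mult_left_le[of "norm b" "norm (id_blinfun + T)"]
      by (simp add: blinfun.add_left)
  qed
  finally have 1: "norm u + 1 - \<delta> < norm (id_blinfun + T) + 2 * \<delta>" by simp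
  \<comment> \<open>All \<open>x n\<close> lie in one slice of \<open>f o\<^sub>L T\<close>, so the
    lower bound for \<open>f\<close> passes to convex combinations and bounds \<open>norm u\<close>
    from below.\<close>
  have "convex hull ((\<lambda>n. T (x n)) ` {0..}) \<subseteq> blinfun_apply f -` {norm T - \<delta><..}"
    using fx by (intro hull_minimal convex_linear_vimage)
      (auto simp: bounded_linear.linear blinfun.bounded_linear_right)
  then have "norm T - \<delta> < f u" using u by auto
  then have "norm T - \<delta> < norm u" using abs_blinfun_le[OF f(1), of u] by simp
  then show "1 + norm T \<le> norm (id_blinfun + T) + e"
    using 1 by (simp add: \<delta>_def)
qed

subsection \<open>Norming bilinear maps\<close>

text \<open>Bounded bilinearity bounds the set in \<open>bilinear_norm\<close>, so that the supremum
  really is an upper bound.\<close>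

lemma norming_norm_le_1:
  assumes "norming B0" "norm x \<le> 1" "norm y \<le> 1"
  shows "norm (B0 x y) \<le> 1"
proof -
  interpret bounded_bilinear B0 using assms(1) by (simp add: norming_def)
  obtain K where K: "K \<ge> 0" "\<And>a b. norm (B0 a b) \<le> norm a * norm b * K"
    using nonneg_bounded by blast
  have "norm (B0 a b) \<le> K" if "norm a \<le> 1" "norm b \<le> 1" for a b
  proof -
    have "norm a * norm b * K \<le> 1 * K"
      using that K(1) by (intro mult_right_mono mult_le_one) auto
    then show ?thesis using K(2)[of a b] by simp
  qed
  then have "bdd_above ((\<lambda>(x, y). norm (B0 x y)) ` (cball 0 1 \<times> cball 0 1))"
    by (intro bdd_aboveI2[where M = K]) auto
  then have "(\<lambda>(x, y). norm (B0 x y)) (x, y) \<le> bilinear_norm B0"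
    unfolding bilinear_norm_def using assms(2,3) by (intro cSUP_upper) auto
  then show ?thesis using assms(1) by (simp add: norming_def)
qed

lemma norming_ballE:
  assumes "norming B0" "norm z < 1"
  obtains x y where "norm x \<le> 1" "norm y \<le> 1" "B0 x y = z"
proof -
  have "z \<in> (\<lambda>(x, y). B0 x y) ` (ball 0 1 \<times> ball 0 1)"
    using assms by (simp add: norming_def)
  then show ?thesis using that by force
qed

text \<open>One inequality holds because \<open>B0\<close> maps into the closed unit ball. For the
  other, a point of the open ball where \<open>T\<close> almost attains its norm has a preimage
  under \<open>B0\<close>.\<close>

lemma bilinear_norm_comp_norming:
  fixes B0 :: "'x::real_normed_vector \<Rightarrow> 'y::real_normed_vector \<Rightarrow> 'z::real_normed_vector"
    and T :: "'z \<Rightarrow>\<^sub>L 'w::real_normed_vector"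
  assumes B0: "norming B0"
  shows "bilinear_norm (comp_bilinear T B0) = norm T"
proof -
  let ?f = "\<lambda>(x, y). norm (T (B0 x y))" and ?S = "cball (0::'x) 1 \<times> cball (0::'y) 1"
  have le: "norm (T (B0 x y)) \<le> norm T" if "norm x \<le> 1" "norm y \<le> 1" for x y
    using norm_blinfun[of T "B0 x y"] norming_norm_le_1[OF B0 that]
      mult_left_le[of "norm (B0 x y)" "norm T"] by simp
  have bdd: "bdd_above (?f ` ?S)"
    using le by (intro bdd_aboveI2[where M = "norm T"]) auto
  have "(SUP p\<in>?S. ?f p) = norm T"
  proof (rule antisym)
    have "?S \<noteq> {}" by (auto intro!: exI[of _ 0])
    then show "(SUP p\<in>?S. ?f p) \<le> norm T"
      using le by (intro cSUP_least) auto
    show "norm T \<le> (SUP p\<in>?S. ?f p)"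
    proof (rule dense_le)
      fix r assume "r < norm T"
      then obtain z where z: "z \<in> ball 0 1" "r < norm (T z)" by (rule less_norm_blinfunE)
      obtain x y where xy: "norm x \<le> 1" "norm y \<le> 1" "B0 x y = z"
        using norming_ballE[OF B0] z(1) by auto
      have "?f (x, y) \<le> (SUP p\<in>?S. ?f p)"
        using xy by (intro cSUP_upper bdd) auto
      then show "r \<le> (SUP p\<in>?S. ?f p)" using z(2) xy by simp
    qed
  qed
  then show ?thesis by (simp add: bilinear_norm_def comp_bilinear_def)
qed

lemma B0_daugavet_property_comp_iff:
  assumes B0: "norming B0"
  shows "B0_daugavet_property B0 ((\<lambda>T. comp_bilinear T B0) ` V) \<longleftrightarrow>
    (\<forall>T\<in>V. norm (id_blinfun + T) = 1 + norm T)"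
proof -
  \<comment> \<open>\<open>B0\<close> is itself its composition with the identity, so both sides of
    the equation become operator norms.\<close>
  have "(\<lambda>x y. B0 x y + comp_bilinear T B0 x y) = comp_bilinear (id_blinfun + T) B0" for T
    by (simp add: comp_bilinear_def blinfun.add_left)
  then show ?thesis
    by (simp add: B0_daugavet_property_def bilinear_norm_comp_norming[OF B0])
qed

text \<open>A point of the smaller slice given by \<open>daugavet_property_slice\<close> is pulled
  back through \<open>B0\<close>.\<close>

lemma daugavet_property_imp_bilinear_slice:
  fixes B0 :: "'x::real_normed_vector \<Rightarrow> 'y::real_normed_vector \<Rightarrow> 'z::real_normed_vector"
  assumes B0: "norming B0" and D: "daugavet_property TYPE('z)"
    and z': "norm z' = 1" and z: "norm z = 1" and "\<epsilon> > 0"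
  shows "\<exists>(x, y)\<in>bilinear_slice (comp_bilinear z' B0) \<epsilon>. norm (z + B0 x y) \<ge> 2 - \<epsilon>"
proof -
  obtain x0 where "x0 \<in> ball 0 1" "1 - \<epsilon> < norm (z' x0)"
    using less_norm_blinfunE[of "1 - \<epsilon>" z'] z' \<open>\<epsilon> > 0\<close> by auto
  then have "x0 \<in> open_slice z' (1 - \<epsilon>) \<or> - x0 \<in> open_slice z' (1 - \<epsilon>)"
    by (auto simp: open_slice_def blinfun.minus_right abs_if split: if_splits)
  then have "open_slice z' (1 - \<epsilon>) \<noteq> {}" by blast
  then obtain h c where h: "open_slice h c \<noteq> {}" "open_slice h c \<subseteq> open_slice z' (1 - \<epsilon>)"
    "\<And>w. w \<in> open_slice h c \<Longrightarrow> norm (z + w) > 2 - \<epsilon>"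
    using daugavet_property_slice[OF D z \<open>\<epsilon> > 0\<close>] by metis
  then obtain w where w: "w \<in> open_slice h c" by blast
  then have w': "norm w < 1" "z' w > 1 - \<epsilon>" using h(2) by (auto simp: open_slice_def)
  obtain x y where "norm x \<le> 1" "norm y \<le> 1" "B0 x y = w"
    using norming_ballE[OF B0 w'(1)] by blast
  then show ?thesis
    using w' h(3)[OF w] by (intro bexI[of _ "(x, y)"]) (auto simp: bilinear_slice_def comp_bilinear_def)
qed

text \<open>With \<open>f = l *\<^sub>R z'\<close>, a point \<open>w = B0 x y\<close> of the slice
  has \<open>Q w\<close> close to \<open>l *\<^sub>R z\<close>, and \<open>l *\<^sub>R z + w\<close>
  has norm almost \<open>l + 1\<close>.\<close>

lemma bilinear_slice_imp_daugavet_property: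
  fixes B0 :: "'x::real_normed_vector \<Rightarrow> 'y::real_normed_vector \<Rightarrow> 'z::real_normed_vector"
  assumes B0: "norming B0"
    and slice: "\<And>(z' :: 'z \<Rightarrow>\<^sub>L real) z \<epsilon>. norm z' = 1 \<Longrightarrow> norm z = 1 \<Longrightarrow> \<epsilon> > 0 \<Longrightarrow>
      \<exists>(x, y)\<in>bilinear_slice (comp_bilinear z' B0) \<epsilon>. norm (z + B0 x y) \<ge> 2 - \<epsilon>"
  shows "daugavet_property TYPE('z)"
  unfolding daugavet_property_def
proof
  fix Q :: "'z \<Rightarrow>\<^sub>L 'z" assume "Q \<in> rank_one_operators"
  then obtain f :: "'z \<Rightarrow>\<^sub>L real" and z where z: "norm z = 1" and Q: "\<And>x. Q x = f x *\<^sub>R z"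
    by (rule rank_one_operatorE) blast
  have nQ: "norm Q = norm f" by (rule norm_rank_one_blinfun[OF Q z])
  show "norm (id_blinfun + Q) = 1 + norm Q"
  proof (cases "f = 0")
    case True
    then have "Q = 0" using nQ by simp
    have "z = id_blinfun z" by simp
    then have "1 \<le> norm (id_blinfun :: 'z \<Rightarrow>\<^sub>L 'z)" using norm_blinfun[of id_blinfun z] z by simp
    then show ?thesis using norm_blinfun_id_le[where 'a = 'z] \<open>Q = 0\<close> by simp
  next
    case False
    define l where "l = norm f"
    define z' where "z' = f /\<^sub>R l"
    have l: "l > 0" and z': "norm z' = 1" "f x = l * z' x" for x
      using False by (auto simp: l_def z'_def blinfun.scaleR_left)
    show ?thesis
    proof (rule antisym[OF norm_id_add_le], rule field_le_epsilon)
      fix e :: real assume "e > 0"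
      \<comment> \<open>The scaled estimate costs \<open>(1 + l) * \<epsilon>\<close>, and replacing
        \<open>l *\<^sub>R z\<close> by \<open>Q w\<close> costs another
        \<open>l * \<epsilon>\<close>.\<close>
      define \<epsilon> where "\<epsilon> = e / (1 + 2 * l)"
      have e: "\<epsilon> > 0" "(1 + 2 * l) * \<epsilon> = e" using \<open>e > 0\<close> l by (auto simp: \<epsilon>_def field_simps)
      obtain x y where xy: "norm x \<le> 1" "norm y \<le> 1" "z' (B0 x y) \<ge> 1 - \<epsilon>" "norm (z + B0 x y) \<ge> 2 - \<epsilon>"
        using slice[OF z'(1) z e(1)] by (auto simp: bilinear_slice_def comp_bilinear_def)
      define w where "w = B0 x y"
      have w: "norm w \<le> 1" "z' w \<ge> 1 - \<epsilon>" "norm (z + w) \<ge> 2 - \<epsilon>"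
        using xy norming_norm_le_1[OF B0] by (auto simp: w_def)
      have "z' w \<le> 1" using abs_blinfun_le[of z' w] z' w by simp
      have "l + 1 - (1 + l) * \<epsilon> \<le> norm (l *\<^sub>R z + 1 *\<^sub>R w)"
        using w z l e by (intro norm_add_scaled_ge) auto
      also have "l *\<^sub>R z + 1 *\<^sub>R w = (id_blinfun + Q) w + (l * (1 - z' w)) *\<^sub>R z"
        by (simp add: blinfun.add_left Q z'(2) algebra_simps)
      also have "norm \<dots> \<le> norm ((id_blinfun + Q) w) + l * (1 - z' w)"
        using norm_triangle_ineq[of "(id_blinfun + Q) w" "(l * (1 - z' w)) *\<^sub>R z"] z l \<open>z' w \<le> 1\<close>
        by simp
      also have "l * (1 - z' w) \<le> l * \<epsilon>" using l w by (intro mult_left_mono) auto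
      also have "norm ((id_blinfun + Q) w) \<le> norm (id_blinfun + Q)"
        using norm_blinfun[of "id_blinfun + Q" w] mult_left_le[OF w(1), of "norm (id_blinfun + Q)"] by simp
      finally show "1 + norm Q \<le> norm (id_blinfun + Q) + e"
        using nQ e(2) by (simp add: l_def algebra_simps)
    qed
  qed
qed

theorem corollary3p10:
  fixes B0 :: "'x::banach \<Rightarrow> 'y::banach \<Rightarrow> 'z::banach"
  assumes "norming B0"
  shows "(daugavet_property TYPE('z) \<longleftrightarrow>
            B0_daugavet_property B0 ((\<lambda>T. comp_bilinear T B0) ` rank_one_operators)) \<and>
         (daugavet_property TYPE('z) \<longleftrightarrow>
            B0_daugavet_property B0 ((\<lambda>T. comp_bilinear T B0) ` compact_operators)) \<and>
         (daugavet_property TYPE('z) \<longleftrightarrow>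
            B0_daugavet_property B0 ((\<lambda>T. comp_bilinear T B0) ` weakly_compact_operators)) \<and>
         (daugavet_property TYPE('z) \<longleftrightarrow>
            (\<forall>z'\<in>sphere (0 :: 'z \<Rightarrow>\<^sub>L real) 1. \<forall>z\<in>sphere (0 :: 'z) 1. \<forall>\<epsilon>>0.
               \<exists>(x, y)\<in>bilinear_slice (comp_bilinear z' B0) \<epsilon>. norm (z + B0 x y) \<ge> 2 - \<epsilon>))"
proof -
  let ?DE = "\<lambda>V :: ('z \<Rightarrow>\<^sub>L 'z) set. \<forall>T\<in>V. norm (id_blinfun + T) = 1 + norm T"
  \<comment> \<open>On the zero space no operator has rank one, yet the weakly compact operator 0
    violates the equation; \<open>bilinear_norm B0 = 1\<close> excludes this case.\<close>
  have nontriv: "\<exists>v::'z. v \<noteq> 0"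
  proof (rule ccontr)
    assume "\<not> ?thesis"
    then have "B0 x y = 0" for x y by blast
    then have "bilinear_norm B0 = 0"
      by (simp add: bilinear_norm_def case_prod_unfold)
    then show False using assms by (simp add: norming_def)
  qed
  have WC: "daugavet_property TYPE('z) \<Longrightarrow> ?DE weakly_compact_operators"
    using daugavet_equation_weakly_compact[OF _ nontriv] by blast
  have R: "daugavet_property TYPE('z) \<longleftrightarrow> ?DE rank_one_operators"
    by (simp add: daugavet_property_def)
  have C: "?DE weakly_compact_operators \<Longrightarrow> ?DE compact_operators" "?DE compact_operators \<Longrightarrow> ?DE rank_one_operators"
    using compact_operators_subset rank_one_operators_subset by blast+
  have S: "daugavet_property TYPE('z) \<longleftrightarrow>
      (\<forall>z'\<in>sphere (0 :: 'z \<Rightarrow>\<^sub>L real) 1. \<forall>z\<in>sphere (0 :: 'z) 1. \<forall>\<epsilon>>0.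
         \<exists>(x, y)\<in>bilinear_slice (comp_bilinear z' B0) \<epsilon>. norm (z + B0 x y) \<ge> 2 - \<epsilon>)"
    (is "?D \<longleftrightarrow> ?S")
  proof
    assume ?D
    then show ?S using daugavet_property_imp_bilinear_slice[OF assms] by simp
  next
    assume ?S
    then show ?D by (intro bilinear_slice_imp_daugavet_property[OF assms]) simp
  qed
  show ?thesis
    unfolding B0_daugavet_property_comp_iff[OF assms] using WC R C S by blast
qed

end
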